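(* Let $\Phi_1,\Phi_4,\Phi_6:[0,\infty)\to\mathbb R$ be arbitrary nowhere-vanishing functions, let $\xi,f,\gamma:[0,\infty)\to\mathbb R$ be arbitrary functions, and let $a\in\mathbb R$. For $0\le s\le t$ put $$a_i^{[s,t]}=\frac{\Phi_i(t)}{\Phi_i(s)}\ (i=1,4,6),\qquad a_2^{[s,t]}=\frac{\Phi_4(t)}{\Phi_1(s)}\big(\xi(t)-\xi(s)\big),\qquad a_5^{[s,t]}=\frac{\Phi_6(t)}{\Phi_4(s)}\big(f(t)-f(s)\big),$$ $$a_3^{[s,t]}=\frac{\Phi_6(t)}{\Phi_1(s)}\Big[a f(s)\xi(s)-f(t)\xi(s)+(1-a)f(t)\xi(t)+\gamma(t)-\gamma(s)\Big].$$ Then the family of matrices $$\mathcal M^{[s,t]}=\begin{pmatrix} a_1^{[s,t]}&a_2^{[s,t]}&a_3^{[s,t]}\\ 0&a_4^{[s,t]}&a_5^{[s,t]}\\ 0&0&a_6^{[s,t]}\end{pmatrix}$$ generates a chain of evolution algebras, i.e. it is the family of matrices of structural constants of a chain of three-dimensional evolution algebras.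
   Context: A family $\{E^{[s,t]}: s,t\in\mathbb R,\ 0\le s\le t\}$ of $n$-dimensional evolution algebras over $\mathbb R$ consists of algebras with common basis $e_1,\dots,e_n$ and multiplication $e_ie_i=\sum_{j=1}^n a_{ij}^{[s,t]}e_j$, $e_ie_j=0$ for $i\ne j$; $\mathcal M^{[s,t]}=(a_{ij}^{[s,t]})$ is its matrix of structural constants. The family is a chain of evolution algebras if $\mathcal M^{[s,t]}=\mathcal M^{[s,\tau]}\mathcal M^{[\tau,t]}$ for all $0\le s<\tau<t$. *)

theory Defs
  imports "HOL-Analysis.Analysis"
begin

definition is_basis :: "('n::finite \<Rightarrow> 'v::real_vector) \<Rightarrow> bool" where
  "is_basis e \<longleftrightarrow> inj e \<and> independent (range e) \<and> span (range e) = UNIV"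

text \<open>
  \<open>mul\<close> is the multiplication of an \<open>n\<close>-dimensional real evolution algebra on the space \<open>'v\<close>,
  with natural basis \<open>e\<close> and matrix of structural constants \<open>A\<close>, where \<open>A $ i $ j\<close> is the
  coefficient of \<open>e j\<close> in \<open>e i * e i\<close>. Since \<open>e\<close> is a basis, \<open>mul\<close> determines \<open>A\<close>
  and \<open>A\<close> determines \<open>mul\<close>.
\<close>
definition evolution_algebra ::
    "('n::finite \<Rightarrow> 'v::real_vector) \<Rightarrow> real^'n^'n \<Rightarrow> ('v \<Rightarrow> 'v \<Rightarrow> 'v) \<Rightarrow> bool" where
  "evolution_algebra e A mul \<longleftrightarrow>
     is_basis e \<and> bilinear mul \<and>
     (\<forall>i. mul (e i) (e i) = (\<Sum>j\<in>UNIV. (A $ i $ j) *\<^sub>R e j)) \<and>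
     (\<forall>i j. i \<noteq> j \<longrightarrow> mul (e i) (e j) = 0)"

text \<open>
  The family \<open>mul s t\<close> is indexed by \<open>0 \<le> s \<le> t\<close> only; values at other indices are irrelevant.
  All members share the underlying space and the basis \<open>e\<close>.
\<close>
definition chain_of_evolution_algebras ::
    "('n::finite \<Rightarrow> 'v::real_vector) \<Rightarrow> (real \<Rightarrow> real \<Rightarrow> real^'n^'n) \<Rightarrow>
     (real \<Rightarrow> real \<Rightarrow> 'v \<Rightarrow> 'v \<Rightarrow> 'v) \<Rightarrow> bool" where
  "chain_of_evolution_algebras e M mul \<longleftrightarrow>
     (\<forall>s t. 0 \<le> s \<and> s \<le> t \<longrightarrow> evolution_algebra e (M s t) (mul s t)) \<and>
     (\<forall>s \<tau> t. 0 \<le> s \<and> s < \<tau> \<and> \<tau> < t \<longrightarrow> M s t = M s \<tau> ** M \<tau> t)"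

definition generates_chain ::
    "('n::finite \<Rightarrow> 'v::real_vector) \<Rightarrow> (real \<Rightarrow> real \<Rightarrow> real^'n^'n) \<Rightarrow> bool" where
  "generates_chain e M \<longleftrightarrow> (\<exists>mul. chain_of_evolution_algebras e M mul)"

end

theory Submission
  imports Defs
begin

text \<open>Every matrix is the structure matrix of an evolution algebra on the given basis
  (\<open>evolution_algebra_exists\<close>), so by \<open>generates_chainI\<close> only the matrix
  equation for \<open>M\<close> remains. That equation has a conceptual source: \<open>M s t\<close>
  is the inverse of \<open>P s\<close> times \<open>P t\<close>, where \<open>P t\<close> is the
  upper unitriangular matrix with entries \<open>\<xi> t\<close>, \<open>g t\<close>,
  \<open>f t\<close> above the diagonal, multiplied on the right by the diagonal matrix of the three
  \<Phi> values, and \<open>g t = (1 - a) * f t * \<xi> t + \<gamma> t\<close>. The middle factors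
  \<open>P \<tau>\<close> then cancel. The proof checks the same fact entry by entry, using
  \<open>upper_triangular_mult_3\<close>.\<close>

definition coord :: "('n::finite \<Rightarrow> 'v::real_vector) \<Rightarrow> 'n \<Rightarrow> 'v \<Rightarrow> real" where
  "coord e i x = representation (range e) x (e i)"

lemma coord_basis:
  assumes "is_basis e"
  shows "coord e i (e j) = (if i = j then 1 else 0)"
  using assms by (auto simp: is_basis_def coord_def representation_basis inj_eq)

lemma linear_coord:
  assumes "is_basis e"
  shows "linear (coord e i)"
  using assms
  by (intro linearI) (simp_all add: is_basis_def coord_def representation_add representation_scale)

text \<open>Multiply coordinatewise and send the \<open>i\<close>-th product to row \<open>i\<close>
  of \<open>A\<close>, read as a vector in the basis. Linearity of the coordinates gives
  bilinearity, and products of distinct basis vectors vanish because no coordinate is nonzero on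
  both.\<close>

lemma evolution_algebra_exists:
  assumes "is_basis e"
  shows "\<exists>mul. evolution_algebra e A mul"
proof -
  define mul where
    "mul x y = (\<Sum>i\<in>UNIV. (coord e i x * coord e i y) *\<^sub>R (\<Sum>j\<in>UNIV. (A $ i $ j) *\<^sub>R e j))" for x y
  have "bilinear mul"
    unfolding bilinear_def mul_def using linear_coord [OF assms]
    by (auto intro!: linearI
        simp: linear_add linear_scale algebra_simps scaleR_right.sum sum.distrib)
  moreover have "mul (e i) (e j) = (if i = j then \<Sum>k\<in>UNIV. (A $ i $ k) *\<^sub>R e k else 0)" for i j
  proof -
    have "mul (e i) (e j) =
        (\<Sum>k\<in>UNIV. if k = i then if i = j then \<Sum>l\<in>UNIV. (A $ i $ l) *\<^sub>R e l else 0 else 0)"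
      unfolding mul_def coord_basis [OF assms] by (rule sum.cong) auto
    then show ?thesis
      by simp
  qed
  ultimately have "evolution_algebra e A mul"
    using assms by (simp add: evolution_algebra_def)
  then show ?thesis
    by blast
qed

lemma generates_chainI:
  assumes "is_basis e"
    and "\<And>s \<tau> t. 0 \<le> s \<Longrightarrow> s < \<tau> \<Longrightarrow> \<tau> < t \<Longrightarrow> M s t = M s \<tau> ** M \<tau> t"
  shows "generates_chain e M"
proof -
  \<comment> \<open>Choosing one multiplication per matrix yields the whole family at once, by
    composition with \<open>M\<close>.\<close>
  obtain mul where "\<And>A. evolution_algebra e A (mul A)"
    using choice [of "evolution_algebra e"] evolution_algebra_exists [OF assms(1)] by blast
  then have "chain_of_evolution_algebras e M (\<lambda>s t. mul (M s t))"
    using assms(2) by (simp add: chain_of_evolution_algebras_def)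
  then show ?thesis
    by (auto simp: generates_chain_def)
qed

text \<open>Reduces the chain equation to six scalar identities, one for each entry on or above the
  diagonal.\<close>

lemma upper_triangular_mult_3:
  "(vector [vector [a, b, c], vector [0, d, x], vector [0, 0, y]] :: 'a::comm_semiring_1^3^3) **
     vector [vector [a', b', c'], vector [0, d', x'], vector [0, 0, y']] =
   (vector [vector [a * a', a * b' + b * d', a * c' + b * x' + c * y'],
           vector [0, d * d', d * x' + x * y'],
           vector [0, 0, y * y']] :: 'a^3^3)"
  by (simp add: vec_eq_iff forall_3 matrix_matrix_mult_def sum_3)

theorem proposition1:
  fixes \<Phi>\<^sub>1 \<Phi>\<^sub>4 \<Phi>\<^sub>6 \<xi> f \<gamma> :: "real \<Rightarrow> real" and a :: real
    and a\<^sub>1 a\<^sub>2 a\<^sub>3 a\<^sub>4 a\<^sub>5 a\<^sub>6 :: "real \<Rightarrow> real \<Rightarrow> real"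
    and M :: "real \<Rightarrow> real \<Rightarrow> real^3^3"
    and e :: "3 \<Rightarrow> 'v::real_vector"
  assumes "is_basis e"
    and "\<And>t. 0 \<le> t \<Longrightarrow> \<Phi>\<^sub>1 t \<noteq> 0"
    and "\<And>t. 0 \<le> t \<Longrightarrow> \<Phi>\<^sub>4 t \<noteq> 0"
    and "\<And>t. 0 \<le> t \<Longrightarrow> \<Phi>\<^sub>6 t \<noteq> 0"
    and "\<And>s t. 0 \<le> s \<Longrightarrow> s \<le> t \<Longrightarrow> a\<^sub>1 s t = \<Phi>\<^sub>1 t / \<Phi>\<^sub>1 s"
    and "\<And>s t. 0 \<le> s \<Longrightarrow> s \<le> t \<Longrightarrow> a\<^sub>4 s t = \<Phi>\<^sub>4 t / \<Phi>\<^sub>4 s"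
    and "\<And>s t. 0 \<le> s \<Longrightarrow> s \<le> t \<Longrightarrow> a\<^sub>6 s t = \<Phi>\<^sub>6 t / \<Phi>\<^sub>6 s"
    and "\<And>s t. 0 \<le> s \<Longrightarrow> s \<le> t \<Longrightarrow> a\<^sub>2 s t = \<Phi>\<^sub>4 t / \<Phi>\<^sub>1 s * (\<xi> t - \<xi> s)"
    and "\<And>s t. 0 \<le> s \<Longrightarrow> s \<le> t \<Longrightarrow> a\<^sub>5 s t = \<Phi>\<^sub>6 t / \<Phi>\<^sub>4 s * (f t - f s)"
    and "\<And>s t. 0 \<le> s \<Longrightarrow> s \<le> t \<Longrightarrow>
           a\<^sub>3 s t = \<Phi>\<^sub>6 t / \<Phi>\<^sub>1 s *
             (a * f s * \<xi> s - f t * \<xi> s + (1 - a) * f t * \<xi> t + \<gamma> t - \<gamma> s)"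
    and "\<And>s t. 0 \<le> s \<Longrightarrow> s \<le> t \<Longrightarrow>
           M s t = vector [vector [a\<^sub>1 s t, a\<^sub>2 s t, a\<^sub>3 s t],
                           vector [0,      a\<^sub>4 s t, a\<^sub>5 s t],
                           vector [0,      0,      a\<^sub>6 s t]]"
  shows "generates_chain e M"
proof (rule generates_chainI)
  fix s \<tau> t :: real
  assume st: "0 \<le> s" "s < \<tau>" "\<tau> < t"
  \<comment> \<open>Denominators carry the first time argument of an entry, here \<open>s\<close> or
    \<open>\<tau>\<close>.\<close>
  then have nz: "\<Phi>\<^sub>1 s \<noteq> 0" "\<Phi>\<^sub>1 \<tau> \<noteq> 0" "\<Phi>\<^sub>4 s \<noteq> 0" "\<Phi>\<^sub>4 \<tau> \<noteq> 0" "\<Phi>\<^sub>6 s \<noteq> 0" "\<Phi>\<^sub>6 \<tau> \<noteq> 0"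
    using assms(2-4) by auto
  have "a\<^sub>1 s t = a\<^sub>1 s \<tau> * a\<^sub>1 \<tau> t" "a\<^sub>4 s t = a\<^sub>4 s \<tau> * a\<^sub>4 \<tau> t" "a\<^sub>6 s t = a\<^sub>6 s \<tau> * a\<^sub>6 \<tau> t"
    using st nz by (simp_all add: assms(5-7))
  \<comment> \<open>After the \<Phi> factors at \<open>\<tau>\<close> cancel, the differences of
    \<xi> telescope; the same happens for \<open>f\<close> in the next entry.\<close>
  moreover have "a\<^sub>2 s t = a\<^sub>1 s \<tau> * a\<^sub>2 \<tau> t + a\<^sub>2 s \<tau> * a\<^sub>4 \<tau> t"
    using st nz by (simp add: assms(5,6,8)) (simp add: field_simps)
  moreover have "a\<^sub>5 s t = a\<^sub>4 s \<tau> * a\<^sub>5 \<tau> t + a\<^sub>5 s \<tau> * a\<^sub>6 \<tau> t"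
    using st nz by (simp add: assms(6,7,9)) (simp add: field_simps)
  \<comment> \<open>All terms share the factor \<open>\<Phi>\<^sub>6 t / \<Phi>\<^sub>1 s\<close>.
    The two brackets coming from \<open>a\<^sub>3\<close> do not telescope by themselves; the cross
    term \<open>(\<xi> \<tau> - \<xi> s) * (f t - f \<tau>)\<close> from \<open>a\<^sub>2\<close>
    and \<open>a\<^sub>5\<close> supplies exactly the missing difference. The terms in
    \<open>f \<tau> * \<xi> \<tau>\<close> have coefficients \<open>a\<close>, \<open>1 - a\<close>
    and \<open>-1\<close>, which sum to zero.\<close>
  moreover have "a\<^sub>3 s t = a\<^sub>1 s \<tau> * a\<^sub>3 \<tau> t + a\<^sub>2 s \<tau> * a\<^sub>5 \<tau> t + a\<^sub>3 s \<tau> * a\<^sub>6 \<tau> t"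
    using st nz by (simp add: assms(5,7-10)) (simp add: field_simps)
  ultimately show "M s t = M s \<tau> ** M \<tau> t"
    using st by (simp add: assms(11) upper_triangular_mult_3)
qed (rule assms(1))

end
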